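(* Let $s_0,s_f,v_0,v_f\in\mathbb{R}$, let $r_1:=v_0+s_0-s_f$ and $r_2:=v_0-v_f$ be the parameters associated with the boundary conditions of Problem (P), and let the constraint map $h=(h_1,h_2)$, the function $L$ and the dual function $q$ be as in the context. Then the following hold. (i) The control and state variables obtained by the PDP method as solution of Problem (P) comply with the analytical solution of (P), namely, for all $t\in[0,1]$, $$u(t)=c_1t+c_2,\quad x_1(t)=\tfrac16c_1t^3+\tfrac12c_2t^2+v_0t+s_0,\quad x_2(t)=\tfrac12c_1t^2+c_2t+v_0,$$ where $$c_1=-12(s_f-s_0)+6(v_0+v_f),\qquad c_2=6(s_f-s_0)-2(2v_0+v_f).$$ (ii) The least exact penalty parameter for Problem (P) is given by $$\bar c=\max\{|12r_1-6r_2|,\;|-6r_1+4r_2|\},$$ with the optimal dual value $\bar q:=q(\bar c)=6r_1^2-6r_1r_2+2r_2^2$.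
   Context: Problem (P): minimize $\frac12\int_0^1u^2(t)\,dt$ over $u\in\mathcal{L}^2([0,1];\mathbb{R})$ subject to $\dot x_1=x_2$, $\dot x_2=u$, $x_1(0)=s_0$, $x_1(1)=s_f$, $x_2(0)=v_0$, $x_2(1)=v_f$. Here $u$ is the control variable and $x_1,x_2$ are the state variables; for a given $u$, the corresponding states are $x_2(t)=v_0+\int_0^tu(s)\,ds$ and $x_1(t)=s_0+\int_0^tx_2(\tau)\,d\tau$. The constraint map is $h(u)=(h_1(u),h_2(u))$ with $$h_1(u):=r_1+\int_0^1\Big[\int_0^\tau u(s)\,ds\Big]d\tau,\qquad h_2(u):=r_2+\int_0^1u(\tau)\,d\tau,$$ and (P) is equivalent to minimizing $\varphi(u):=\frac12\int_0^1u^2(t)\,dt$ subject to $h(u)=0$. For $c\ge0$, $$L(u,c):=\varphi(u)+c\,\big(|h_1(u)|+|h_2(u)|\big),\qquad q(c):=\inf_{u\in\mathcal{L}^2([0,1];\mathbb{R})}L(u,c).$$ For $c>0$ the function $L(\cdot,c)$ has a unique minimizer. The dual problem is $\max_{c\ge0}q(c)$. $S(P)$ denotes the set of (primal) solutions of (P) and $M_P$ its optimal value. PDP (primal–dual penalty) algorithm: let $\alpha,\varepsilon>0$ and choose a sequence $\{\alpha_k\}\subset(0,\alpha)$. Step 0: choose $c_0>0$ and set $k:=0$. Step 1: (a) find $u_k\in\operatorname{argmin}_{u}L(u,c_k)$; (b) if $\|h(u_k)\|_\infty<\varepsilon$, stop. Step 2: choose $s_k>0$, set $\tilde s_k=(\alpha_k+1)s_k$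 and $c_{k+1}:=c_k+\tilde s_k\|h(u_k)\|_1$; set $k:=k+1$ and go to Step 1. Exact penalty parameter for (P): a positive number $\bar c$ such that for every $c\ge\bar c$ one has $\operatorname{argmin}L(\cdot,c)\subset S(P)$ (in particular $q(c)=M_P$ for $c\ge\bar c$). Least exact penalty parameter for (P): a positive number $\bar c$ that is an exact penalty parameter for (P) and such that for every $c<\bar c$ one has $\operatorname{argmin}L(\cdot,c)\cap S(P)=\emptyset$.
   Formalization: Least exactness in (ii) is claimed only if r_1, r_2 are not both 0 (else c̄=0 is not positive; there only argmin L(·,c)⊂S(P) for c≥c̄ is claimed); (i) concerns PDP outputs with h(u)=0 exactly, as outputs within tolerance ε need not solve (P); u(t) formula holds a.e. *)

theory Defs
  imports "HOL-Analysis.Analysis"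
begin

text \<open>Elements of $L^2([0,1])$ are represented by square-integrable, Lebesgue-measurable functions;
  values outside \<open>{0..1}\<close> are irrelevant, and functions equal almost everywhere on \<open>{0..1}\<close>
  represent the same control.\<close>

definition L2_01 :: "(real \<Rightarrow> real) set" where
  "L2_01 = {u. set_borel_measurable lebesgue {0..1} u \<and>
               set_integrable lebesgue {0..1} (\<lambda>t. (u t)\<^sup>2)}"

definition energy :: "(real \<Rightarrow> real) \<Rightarrow> real" where
  "energy u = 1/2 * (LINT t:{0..1}|lebesgue. (u t)\<^sup>2)"

definition state2 :: "real \<Rightarrow> (real \<Rightarrow> real) \<Rightarrow> real \<Rightarrow> real" where
  "state2 v0 u t = v0 + (LINT s:{0..t}|lebesgue. u s)"

definition state1 :: "real \<Rightarrow> real \<Rightarrow> (real \<Rightarrow> real) \<Rightarrow> real \<Rightarrow> real" where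
  "state1 s0 v0 u t = s0 + (LINT \<tau>:{0..t}|lebesgue. state2 v0 u \<tau>)"

text \<open>The dynamics and the initial conditions are built into the states, so that only the terminal
  conditions remain as constraints on the control.\<close>

definition feasible_P :: "real \<Rightarrow> real \<Rightarrow> real \<Rightarrow> real \<Rightarrow> (real \<Rightarrow> real) \<Rightarrow> bool" where
  "feasible_P s0 sf v0 vf u \<longleftrightarrow>
     u \<in> L2_01 \<and> state1 s0 v0 u 1 = sf \<and> state2 v0 u 1 = vf"

definition solutions_P :: "real \<Rightarrow> real \<Rightarrow> real \<Rightarrow> real \<Rightarrow> (real \<Rightarrow> real) set" where
  "solutions_P s0 sf v0 vf = {u. is_arg_min energy (feasible_P s0 sf v0 vf) u}"

definition constr1 :: "real \<Rightarrow> (real \<Rightarrow> real) \<Rightarrow> real" where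
  "constr1 r1 u = r1 + (LINT \<tau>:{0..1}|lebesgue. (LINT s:{0..\<tau>}|lebesgue. u s))"

definition constr2 :: "real \<Rightarrow> (real \<Rightarrow> real) \<Rightarrow> real" where
  "constr2 r2 u = r2 + (LINT \<tau>:{0..1}|lebesgue. u \<tau>)"

definition constr_norm1 :: "real \<Rightarrow> real \<Rightarrow> (real \<Rightarrow> real) \<Rightarrow> real" where
  "constr_norm1 r1 r2 u = \<bar>constr1 r1 u\<bar> + \<bar>constr2 r2 u\<bar>"

definition constr_norm_inf :: "real \<Rightarrow> real \<Rightarrow> (real \<Rightarrow> real) \<Rightarrow> real" where
  "constr_norm_inf r1 r2 u = max \<bar>constr1 r1 u\<bar> \<bar>constr2 r2 u\<bar>"

definition penalty_fun :: "real \<Rightarrow> real \<Rightarrow> (real \<Rightarrow> real) \<Rightarrow> real \<Rightarrow> real" where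
  "penalty_fun r1 r2 u c = energy u + c * (\<bar>constr1 r1 u\<bar> + \<bar>constr2 r2 u\<bar>)"

text \<open>For \<open>c \<ge> 0\<close> the infimum is over a nonempty set of reals bounded below by \<open>0\<close>.\<close>

definition dual_fun :: "real \<Rightarrow> real \<Rightarrow> real \<Rightarrow> real" where
  "dual_fun r1 r2 c = (INF u\<in>L2_01. penalty_fun r1 r2 u c)"

definition penalty_argmin :: "real \<Rightarrow> real \<Rightarrow> real \<Rightarrow> (real \<Rightarrow> real) set" where
  "penalty_argmin r1 r2 c = {u. is_arg_min (\<lambda>u. penalty_fun r1 r2 u c) (\<lambda>u. u \<in> L2_01) u}"

text \<open>A run of the algorithm that stops at iteration \<open>N\<close> and returns \<open>u N\<close>. The step sizes
  \<open>s k\<close>, the parameters \<open>c k\<close> and the controls \<open>u k\<close> matter only for the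
  iterations that are actually carried out.\<close>

definition pdp_run ::
  "real \<Rightarrow> real \<Rightarrow> real \<Rightarrow> real \<Rightarrow> (nat \<Rightarrow> real) \<Rightarrow> (nat \<Rightarrow> real) \<Rightarrow> (nat \<Rightarrow> real) \<Rightarrow>
   (nat \<Rightarrow> real \<Rightarrow> real) \<Rightarrow> nat \<Rightarrow> bool" where
  "pdp_run r1 r2 \<alpha> \<epsilon> a s c u N \<longleftrightarrow>
     0 < \<alpha> \<and> 0 < \<epsilon> \<and> (\<forall>k. 0 < a k \<and> a k < \<alpha>) \<and>
     0 < c 0 \<and>
     (\<forall>k\<le>N. u k \<in> penalty_argmin r1 r2 (c k)) \<and>
     (\<forall>k<N. \<epsilon> \<le> constr_norm_inf r1 r2 (u k) \<and> 0 < s k \<and>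
            c (Suc k) = c k + (a k + 1) * s k * constr_norm1 r1 r2 (u k)) \<and>
     constr_norm_inf r1 r2 (u N) < \<epsilon>"

text \<open>The parameters \<open>r1\<close> and \<open>r2\<close> of the penalty function are those determined by the
  boundary data of the problem.\<close>

definition exact_penalty_param :: "real \<Rightarrow> real \<Rightarrow> real \<Rightarrow> real \<Rightarrow> real \<Rightarrow> bool" where
  "exact_penalty_param s0 sf v0 vf cbar \<longleftrightarrow>
     0 < cbar \<and>
     (\<forall>c\<ge>cbar. penalty_argmin (v0 + s0 - sf) (v0 - vf) c \<subseteq> solutions_P s0 sf v0 vf)"

text \<open>Penalty parameters range over \<open>c \<ge> 0\<close>.\<close>

definition least_exact_penalty_param :: "real \<Rightarrow> real \<Rightarrow> real \<Rightarrow> real \<Rightarrow> real \<Rightarrow> bool" where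
  "least_exact_penalty_param s0 sf v0 vf cbar \<longleftrightarrow>
     exact_penalty_param s0 sf v0 vf cbar \<and>
     (\<forall>c. 0 \<le> c \<and> c < cbar \<longrightarrow>
          penalty_argmin (v0 + s0 - sf) (v0 - vf) c \<inter> solutions_P s0 sf v0 vf = {})"

end

theory Submission
  imports Defs
begin

text \<open>
  Put \<open>l1 = 12 * r1 - 6 * r2\<close>, \<open>l2 = - 6 * r1 + 4 * r2\<close> (the Lagrange multipliers),
  \<open>w t = - (l1 * (1 - t) + l2)\<close> and \<open>M = 6 * r1\<^sup>2 - 6 * r1 * r2 + 2 * r2\<^sup>2\<close>. Fubini turns the first
  constraint into \<open>r1\<close> plus the integral of \<open>(1 - t) * u t\<close>, and completing the square gives
  \[ L(u,c) = M + \frac12\|u-w\|^2 + (c|h_1(u)| - l_1 h_1(u)) + (c|h_2(u)| - l_2 h_2(u)). \]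
  If \<open>c\<close> is at least both \<open>\<bar>l1\<bar>\<close> and \<open>\<bar>l2\<bar>\<close>, the brackets are nonnegative and \<open>w\<close>
  is the only minimizer up to null sets. If \<open>c\<close> is smaller than one of them, violating the
  corresponding constraint slightly by an affine control brings the value below \<open>M\<close>.
\<close>

section \<open>Lebesgue integration on compact intervals\<close>

lemma sigma_finite_lebesgue: "sigma_finite_measure (lebesgue :: 'a::euclidean_space measure)"
proof
  have "(\<Union>n. cball (0::'a) (real n)) = UNIV"
    using real_arch_simple by (auto simp: set_eq_iff)
  moreover have "emeasure lebesgue (cball (0::'a) (real n)) \<noteq> \<infinity>" for n
    using emeasure_bounded_finite[of "cball (0::'a) (real n)"] by (auto simp: less_top)
  ultimately show "\<exists>A. countable A \<and> A \<subseteq> sets lebesgue \<and> \<Union> A = space (lebesgue :: 'a measure) \<and>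
      (\<forall>a\<in>A. emeasure lebesgue a \<noteq> \<infinity>)"
    by (intro exI[of _ "range (\<lambda>n. cball 0 (real n))"]) auto
qed

lemma set_integral_FTC:
  fixes f F :: "real \<Rightarrow> real"
  assumes "a \<le> b" and "continuous_on {a..b} f"
    and "\<And>t. t \<in> {a..b} \<Longrightarrow> (F has_real_derivative f t) (at t)"
  shows "(LINT t:{a..b}|lebesgue. f t) = F b - F a"
proof -
  have "(f has_integral F b - F a) {a..b}"
    using assms by (intro fundamental_theorem_of_calculus)
      (auto simp flip: has_real_derivative_iff_has_vector_derivative
        intro: has_field_derivative_at_within)
  with absolutely_integrable_continuous_real[OF assms(2)] show ?thesis
    by (simp add: set_lebesgue_integral_eq_integral(2) integral_unique)
qed

lemma set_integral_quadratic:
  fixes x :: real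
  assumes "0 \<le> x"
  shows "(LINT t:{0..x}|lebesgue. a * t\<^sup>2 + b * t + d) = a * x^3 / 3 + b * x\<^sup>2 / 2 + d * x"
proof -
  have "((\<lambda>t. a * t^3 / 3 + b * t\<^sup>2 / 2 + d * t) has_real_derivative a * t\<^sup>2 + b * t + d) (at t)" for t
    by (auto intro!: derivative_eq_intros simp: power2_eq_square)
  from set_integral_FTC[OF assms _ this] show ?thesis
    by (simp add: continuous_intros)
qed

lemma set_integral_affine:
  fixes x :: real
  assumes "0 \<le> x"
  shows "(LINT t:{0..x}|lebesgue. b * t + d) = b * x\<^sup>2 / 2 + d * x"
  using set_integral_quadratic[OF assms, of 0 b d] by simp

section \<open>Square-integrable controls on the unit interval\<close>

lemma L2_01_integrable:
  assumes "u \<in> L2_01"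
  shows "set_integrable lebesgue {0..1} u"
proof (rule set_integrable_bound)
  show "set_integrable lebesgue {0..1} (\<lambda>t. 1 + (u t)\<^sup>2)"
    using assms absolutely_integrable_continuous_real[of 0 1 "\<lambda>_. 1::real"]
    by (intro set_integral_add) (auto simp: L2_01_def)
  have "\<bar>x\<bar> \<le> 1 + x\<^sup>2" for x :: real
  proof -
    \<comment> \<open>The right-hand side expands to x^2 - |x| + 1.\<close>
    have "0 \<le> (\<bar>x\<bar> - 1)\<^sup>2 + \<bar>x\<bar>" by simp
    thus ?thesis by (simp add: power2_eq_square algebra_simps)
  qed
  thus "AE t in lebesgue. t \<in> {0..1} \<longrightarrow> norm (u t) \<le> norm (1 + (u t)\<^sup>2)"
    by (simp add: abs_of_nonneg)
qed (use assms in \<open>simp add: L2_01_def\<close>)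

text \<open>A continuous factor is bounded on the compact interval by some \<open>B\<close>, so
  \<open>B * f\<close> dominates the product.\<close>

lemma set_integrable_mult_continuous:
  fixes f g :: "real \<Rightarrow> real"
  assumes f: "set_integrable lebesgue {a..b} f" and g: "continuous_on {a..b} g"
  shows "set_integrable lebesgue {a..b} (\<lambda>t. f t * g t)"
proof -
  obtain B where B: "\<And>t. t \<in> {a..b} \<Longrightarrow> \<bar>g t\<bar> \<le> B"
    using compact_imp_bounded[OF compact_continuous_image[OF g compact_Icc]]
    unfolding bounded_iff by (metis imageI real_norm_def)
  have gi: "set_integrable lebesgue {a..b} g"
    by (rule absolutely_integrable_continuous_real[OF g])
  show ?thesis
  proof (rule set_integrable_bound)
    show "set_integrable lebesgue {a..b} (\<lambda>t. B * f t)"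
      using f by simp
    \<comment> \<open>Only the truncations to the interval are known to be measurable. As the
      indicator is idempotent, their product is the truncated product.\<close>
    have "(\<lambda>t. (indicator {a..b} t * f t) * (indicator {a..b} t * g t)) \<in> borel_measurable lebesgue"
      using borel_measurable_integrable[OF f[unfolded set_integrable_def]]
        borel_measurable_integrable[OF gi[unfolded set_integrable_def]]
      by (simp only: real_scaleR_def) (rule borel_measurable_times)
    moreover have "(\<lambda>t. (indicator {a..b} t * f t) * (indicator {a..b} t * g t))
        = (\<lambda>t. indicator {a..b} t *\<^sub>R (f t * g t))"
      by (auto simp: indicator_def)
    ultimately show "set_borel_measurable lebesgue {a..b} (\<lambda>t. f t * g t)"
      by (simp add: set_borel_measurable_def)
    have "\<bar>f t * g t\<bar> \<le> \<bar>B * f t\<bar>" if "t \<in> {a..b}" for t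
      using mult_right_mono[OF order_trans[OF B[OF that] abs_ge_self], of "\<bar>f t\<bar>"]
      by (simp add: abs_mult mult.commute)
    thus "AE t in lebesgue. t \<in> {a..b} \<longrightarrow> norm (f t * g t) \<le> norm (B * f t)"
      by simp
  qed
qed

lemma L2_01_continuous:
  assumes "continuous_on {0..1} u"
  shows "u \<in> L2_01"
  using absolutely_integrable_continuous_real[OF assms]
    absolutely_integrable_continuous_real[of 0 1 "\<lambda>t. (u t)\<^sup>2"] assms
  by (auto simp: L2_01_def set_borel_measurable_def set_integrable_def continuous_on_power
      dest: borel_measurable_integrable)

text \<open>The cross term of the expanded square is integrable because \<open>g\<close> is
  continuous and \<open>u\<close> is integrable.\<close>

lemma L2_01_add_continuous:
  assumes u: "u \<in> L2_01" and g: "continuous_on {0..1} g"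
  shows "set_integrable lebesgue {0..1} (\<lambda>t. (u t + g t)\<^sup>2)"
    and "(LINT t:{0..1}|lebesgue. (u t + g t)\<^sup>2)
      = (LINT t:{0..1}|lebesgue. (u t)\<^sup>2) + 2 * (LINT t:{0..1}|lebesgue. u t * g t)
        + (LINT t:{0..1}|lebesgue. (g t)\<^sup>2)"
proof -
  have i: "set_integrable lebesgue {0..1} (\<lambda>t. (u t)\<^sup>2)"
    "set_integrable lebesgue {0..1} (\<lambda>t. 2 * (u t * g t))"
    "set_integrable lebesgue {0..1} (\<lambda>t. (g t)\<^sup>2)"
    using u set_integrable_mult_continuous[OF L2_01_integrable[OF u] g]
      absolutely_integrable_continuous_real[of 0 1 "\<lambda>t. (g t)\<^sup>2"] g
    by (auto simp: L2_01_def continuous_on_power)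
  have eq: "(\<lambda>t. (u t + g t)\<^sup>2) = (\<lambda>t. ((u t)\<^sup>2 + 2 * (u t * g t)) + (g t)\<^sup>2)"
    by (simp add: power2_eq_square algebra_simps)
  show "set_integrable lebesgue {0..1} (\<lambda>t. (u t + g t)\<^sup>2)"
    unfolding eq using i by (intro set_integral_add)
  show "(LINT t:{0..1}|lebesgue. (u t + g t)\<^sup>2)
      = (LINT t:{0..1}|lebesgue. (u t)\<^sup>2) + 2 * (LINT t:{0..1}|lebesgue. u t * g t)
        + (LINT t:{0..1}|lebesgue. (g t)\<^sup>2)"
    unfolding eq using i by (simp add: set_integral_add)
qed

text \<open>Fubini on the triangle 0 <= s <= tau <= 1: for fixed s in the unit interval the outer
  variable runs over an interval of length 1 - s, which is the weight on the right. The first claim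
  is needed to split integrals that contain the inner one.\<close>

lemma set_integral_double:
  fixes u :: "real \<Rightarrow> real"
  assumes "set_integrable lebesgue {0..1} u"
  shows "set_integrable lebesgue {0..1} (\<lambda>\<tau>. LINT s:{0..\<tau>}|lebesgue. u s)"
    and "(LINT \<tau>:{0..1}|lebesgue. (LINT s:{0..\<tau>}|lebesgue. u s))
      = (LINT s:{0..1}|lebesgue. (1 - s) * u s)"
proof -
  interpret L: sigma_finite_measure "lebesgue :: real measure"
    by (rule sigma_finite_lebesgue)
  interpret P: pair_sigma_finite "lebesgue :: real measure" "lebesgue :: real measure" ..
  \<comment> \<open>Nothing is known of \<open>u\<close> outside the unit interval; the truncation
    is integrable over the whole line.\<close>
  define v where "v s = indicator {0..1} s * u s" for s
  define T where "T = {p :: real \<times> real. 0 \<le> snd p \<and> snd p \<le> fst p \<and> fst p \<le> 1}"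
  define f where "f = (\<lambda>\<tau> s. indicator T (\<tau>, s) * v s)"
  have v: "integrable lebesgue v"
    using assms by (simp add: set_integrable_def v_def[abs_def])
  note [measurable] = borel_measurable_integrable[OF v]
  have [measurable]: "(\<lambda>x::real. x) \<in> borel_measurable lebesgue"
    by (rule measurable_completion) simp
  have T [measurable]: "T \<in> sets (lebesgue \<Otimes>\<^sub>M lebesgue)"
  proof -
    have [measurable]: "fst \<in> borel_measurable ((lebesgue :: real measure) \<Otimes>\<^sub>M (lebesgue :: real measure))"
      "snd \<in> borel_measurable ((lebesgue :: real measure) \<Otimes>\<^sub>M (lebesgue :: real measure))"
      using measurable_compose[OF measurable_fst \<open>(\<lambda>x::real. x) \<in> borel_measurable lebesgue\<close>]
        measurable_compose[OF measurable_snd \<open>(\<lambda>x::real. x) \<in> borel_measurable lebesgue\<close>]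
      by simp_all
    have "{p \<in> space (lebesgue \<Otimes>\<^sub>M lebesgue). 0 \<le> snd p \<and> snd p \<le> fst p \<and> fst p \<le> (1::real)}
        \<in> sets (lebesgue \<Otimes>\<^sub>M (lebesgue :: real measure))"
      by measurable
    thus ?thesis by (simp add: T_def space_pair_measure)
  qed
  \<comment> \<open>The two sections of the triangle: \<open>col\<close> fixes the inner variable
    and \<open>row\<close> the outer one. The two iterated integrals are read off from them.\<close>
  have col: "f \<tau> s = indicator {s..1} \<tau> * v s" for \<tau> s
    by (auto simp: f_def T_def v_def indicator_def)
  have row: "f \<tau> s = indicator {0..1} \<tau> * (indicator {0..\<tau>} s * u s)" for \<tau> s
    by (auto simp: f_def T_def v_def indicator_def)
  have int: "integrable (lebesgue \<Otimes>\<^sub>M lebesgue) (case_prod f)"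
  proof (rule Bochner_Integration.integrable_bound)
    \<comment> \<open>The triangle lies in the unit square, so a product of two integrable functions
      of one variable each dominates \<open>f\<close>.\<close>
    have "integrable (lebesgue \<Otimes>\<^sub>M lebesgue) (\<lambda>(\<tau>, s). indicator {0..1::real} \<tau> * v s)"
    proof (rule P.Fubini_integrable)
      have "(\<lambda>\<tau>. \<integral>s. norm (case (\<tau>, s) of (\<tau>, s) \<Rightarrow> indicator {0..1::real} \<tau> * v s) \<partial>lebesgue)
          = (\<lambda>\<tau>. indicator {0..1} \<tau> * (\<integral>s. \<bar>v s\<bar> \<partial>lebesgue))"
        by (auto simp: indicator_def)
      thus "integrable lebesgue
          (\<lambda>\<tau>. \<integral>s. norm (case (\<tau>, s) of (\<tau>, s) \<Rightarrow> indicator {0..1::real} \<tau> * v s) \<partial>lebesgue)"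
        by simp
    qed (use v in \<open>auto simp: case_prod_unfold\<close>)
    thus "integrable (lebesgue \<Otimes>\<^sub>M lebesgue) (\<lambda>(\<tau>, s). indicator {0..1::real} \<tau> * v s)" .
    show "case_prod f \<in> borel_measurable (lebesgue \<Otimes>\<^sub>M lebesgue)"
      unfolding f_def by measurable
    show "AE p in lebesgue \<Otimes>\<^sub>M lebesgue.
        norm (case_prod f p) \<le> norm (case p of (\<tau>, s) \<Rightarrow> indicator {0..1} \<tau> * v s)"
      by (auto simp: f_def T_def indicator_def)
  qed
  have fst: "(\<lambda>\<tau>. \<integral>s. f \<tau> s \<partial>lebesgue)
      = (\<lambda>\<tau>. indicator {0..1} \<tau> *\<^sub>R (LINT s:{0..\<tau>}|lebesgue. u s))"
    by (simp add: row set_lebesgue_integral_def)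
  have snd: "(\<integral>\<tau>. f \<tau> s \<partial>lebesgue) = indicator {0..1} s *\<^sub>R ((1 - s) * u s)" for s
  proof (cases "s \<in> {0..1}")
    case True
    hence "(\<integral>\<tau>. f \<tau> s \<partial>lebesgue) = (\<integral>\<tau>. indicator {s..1} \<tau> \<partial>lebesgue) * u s"
      by (simp add: col v_def)
    also have "(\<integral>\<tau>. indicator {s..1} \<tau> \<partial>lebesgue) = 1 - s"
      using True by simp
    finally show ?thesis using True by simp
  qed (simp add: col v_def)
  show "set_integrable lebesgue {0..1} (\<lambda>\<tau>. LINT s:{0..\<tau>}|lebesgue. u s)"
    using P.integrable_fst'[OF int] by (simp add: set_integrable_def fst)
  show "(LINT \<tau>:{0..1}|lebesgue. (LINT s:{0..\<tau>}|lebesgue. u s))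
      = (LINT s:{0..1}|lebesgue. (1 - s) * u s)"
    using P.Fubini_integral[OF int] by (simp add: set_lebesgue_integral_def fst snd)
qed

section \<open>Affine controls and completing the square\<close>

lemma constr1_eq:
  assumes "u \<in> L2_01"
  shows "constr1 r1 u = r1 + (LINT t:{0..1}|lebesgue. (1 - t) * u t)"
  using set_integral_double(2)[OF L2_01_integrable[OF assms]] by (simp add: constr1_def)

lemma constr1_affine: "constr1 r1 (\<lambda>t. a * t + b) = r1 + a / 6 + b / 2"
proof -
  have "(LINT t:{0..1}|lebesgue. (1 - t) * (a * t + b))
      = (LINT t:{0..1}|lebesgue. (- a) * t\<^sup>2 + (a - b) * t + b)"
    by (simp add: power2_eq_square algebra_simps)
  also have "\<dots> = a / 6 + b / 2"
    by (subst set_integral_quadratic) (auto simp: field_simps)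
  finally show ?thesis
    by (subst constr1_eq) (auto intro!: L2_01_continuous continuous_intros)
qed

lemma constr2_affine: "constr2 r2 (\<lambda>t. a * t + b) = r2 + a / 2 + b"
  by (simp add: constr2_def set_integral_affine)

lemma set_integral_affine_square:
  fixes a b :: real
  shows "(LINT t:{0..1}|lebesgue. (a * t + b)\<^sup>2) = a\<^sup>2 / 3 + a * b + b\<^sup>2"
proof -
  have "(LINT t:{0..1}|lebesgue. (a * t + b)\<^sup>2)
      = (LINT t:{0..1}|lebesgue. a\<^sup>2 * t\<^sup>2 + (2 * a * b) * t + b\<^sup>2)"
    by (simp add: power2_eq_square algebra_simps)
  also have "\<dots> = a\<^sup>2 / 3 + a * b + b\<^sup>2"
    by (subst set_integral_quadratic) (auto simp: field_simps)
  finally show ?thesis .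
qed

lemma energy_nonneg: "0 \<le> energy u"
  by (auto simp: energy_def set_lebesgue_integral_def intro!: integral_nonneg_AE)

text \<open>By \<open>constr1_eq\<close> the constraint terms are constants plus the integral of u*g
  with g(t) = a*(1 - t) + b. Adding \<open>energy u\<close> gives \<open>energy\<close> of u + g
  minus \<open>energy\<close> of g, and the latter is a^2/6 + a*b/2 + b^2/2.\<close>

lemma energy_complete_square:
  assumes u: "u \<in> L2_01"
  shows "energy u + a * constr1 r1 u + b * constr2 r2 u
    = energy (\<lambda>t. u t + (- a * t + (a + b))) + a * r1 + b * r2 - (a\<^sup>2 / 6 + a * b / 2 + b\<^sup>2 / 2)"
proof -
  have g: "continuous_on {0..1} (\<lambda>t. - a * t + (a + b))"
    by (intro continuous_intros)
  have i: "set_integrable lebesgue {0..1} (\<lambda>t. a * ((1 - t) * u t))"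
    using set_integrable_mult_continuous[OF L2_01_integrable[OF u], of "\<lambda>t. 1 - t"]
    by (simp add: mult.commute continuous_on_diff)
  have "(LINT t:{0..1}|lebesgue. u t * (- a * t + (a + b)))
      = (LINT t:{0..1}|lebesgue. a * ((1 - t) * u t) + b * u t)"
    by (simp add: algebra_simps)
  also have "\<dots> = a * (constr1 r1 u - r1) + b * (constr2 r2 u - r2)"
    using i L2_01_integrable[OF u]
    by (simp add: set_integral_add constr1_eq[OF u] constr2_def)
  finally show ?thesis
    unfolding energy_def L2_01_add_continuous(2)[OF u g] set_integral_affine_square
    by (simp add: power2_eq_square field_simps)
qed

lemma energy_add_affine_eq_0:
  assumes u: "u \<in> L2_01" and "energy (\<lambda>t. u t + (a * t + b)) \<le> 0"
  shows "AE t in lebesgue. t \<in> {0..1} \<longrightarrow> u t = - a * t - b"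
proof -
  have g: "continuous_on {0..1} (\<lambda>t. a * t + b)"
    by (intro continuous_intros)
  have "(LINT t:{0..1}|lebesgue. (u t + (a * t + b))\<^sup>2) = 0"
    using assms(2) energy_nonneg[of "\<lambda>t. u t + (a * t + b)"] by (simp add: energy_def)
  \<comment> \<open>Integrability of the square is essential here: a non-integrable function would
    have integral 0 by convention.\<close>
  hence "AE t in lebesgue. indicator {0..1} t *\<^sub>R (u t + (a * t + b))\<^sup>2 = 0"
    using L2_01_add_continuous(1)[OF u g]
    by (subst integral_nonneg_eq_0_iff_AE[symmetric])
       (auto simp: set_integrable_def set_lebesgue_integral_def)
  thus ?thesis
    by eventually_elim (auto simp: indicator_def)
qed

section \<open>States generated by affine controls, and feasibility\<close>

lemma set_integral_AE_cong_subinterval: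
  fixes f g :: "real \<Rightarrow> real"
  assumes "set_integrable lebesgue {0..1} f" "set_integrable lebesgue {0..1} g"
    and "AE t in lebesgue. t \<in> {0..1} \<longrightarrow> f t = g t" and "x \<in> {0..1}"
  shows "(LINT t:{0..x}|lebesgue. f t) = (LINT t:{0..x}|lebesgue. g t)"
  unfolding set_lebesgue_integral_def
proof (rule integral_cong_AE)
  have "set_integrable lebesgue {0..x} f" "set_integrable lebesgue {0..x} g"
    using assms by (auto intro: set_integrable_subset[of _ "{0..1}"])
  thus "(\<lambda>t. indicator {0..x} t *\<^sub>R f t) \<in> borel_measurable lebesgue"
    "(\<lambda>t. indicator {0..x} t *\<^sub>R g t) \<in> borel_measurable lebesgue"
    by (auto simp: set_integrable_def dest: borel_measurable_integrable)
  show "AE t in lebesgue. indicator {0..x} t *\<^sub>R f t = indicator {0..x} t *\<^sub>R g t"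
    using assms(3) by eventually_elim (use assms(4) in \<open>auto simp: indicator_def\<close>)
qed

text \<open>The control is known only almost everywhere, but states are integrals of it, so their
  formulas hold at every time. Once \<open>state2\<close> is known pointwise, \<open>state1\<close>
  is the integral of an explicit quadratic.\<close>

lemma state_affine:
  assumes u: "u \<in> L2_01" and ae: "AE t in lebesgue. t \<in> {0..1} \<longrightarrow> u t = a * t + b"
    and x: "x \<in> {0..1}"
  shows "state2 v0 u x = 1/2 * a * x^2 + b * x + v0"
    and "state1 s0 v0 u x = 1/6 * a * x^3 + 1/2 * b * x^2 + v0 * x + s0"
proof -
  have i: "set_integrable lebesgue {0..1} (\<lambda>t. a * t + b)"
    by (intro absolutely_integrable_continuous_real continuous_intros)
  have s2: "state2 v0 u t = (a / 2) * t^2 + b * t + v0" if "t \<in> {0..1}" for t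
    using set_integral_AE_cong_subinterval[OF L2_01_integrable[OF u] i ae that] that
    by (simp add: state2_def set_integral_affine)
  from s2[OF x] show "state2 v0 u x = 1/2 * a * x^2 + b * x + v0"
    by simp
  have "(LINT t:{0..x}|lebesgue. state2 v0 u t)
      = (LINT t:{0..x}|lebesgue. (a / 2) * t^2 + b * t + v0)"
    using s2 x by (intro set_lebesgue_integral_cong) auto
  also have "\<dots> = (a / 2) * x^3 / 3 + b * x\<^sup>2 / 2 + v0 * x"
    using x by (intro set_integral_quadratic) simp
  finally show "state1 s0 v0 u x = 1/6 * a * x^3 + 1/2 * b * x^2 + v0 * x + s0"
    by (simp add: state1_def)
qed

text \<open>The terminal states exceed their prescribed values exactly by the two constraint values,
  since r1 and r2 collect the boundary data.\<close>

lemma feasible_P_iff: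
  "feasible_P s0 sf v0 vf u \<longleftrightarrow>
    u \<in> L2_01 \<and> constr1 (v0 + s0 - sf) u = 0 \<and> constr2 (v0 - vf) u = 0"
proof (cases "u \<in> L2_01")
  case True
  have "set_integrable lebesgue {0..1::real} (\<lambda>_. v0)"
    by (intro absolutely_integrable_continuous_real continuous_intros)
  with True have "state1 s0 v0 u 1 = sf + constr1 (v0 + s0 - sf) u"
    using set_integral_double(1)[OF L2_01_integrable[OF True]] set_integral_affine[of 1 0 v0]
    by (simp add: state1_def state2_def constr1_def set_integral_add)
  moreover have "state2 v0 u 1 = vf + constr2 (v0 - vf) u"
    by (simp add: state2_def constr2_def)
  ultimately show ?thesis
    using True by (simp add: feasible_P_def)
qed (simp add: feasible_P_def)

section \<open>The penalty function expanded around the candidate \<open>w\<close>\<close>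

locale penalty_problem =
  fixes r1 r2 l1 l2 :: real and w :: "real \<Rightarrow> real" and M :: real
  defines "l1 \<equiv> 12 * r1 - 6 * r2" and "l2 \<equiv> - 6 * r1 + 4 * r2"
    and "w \<equiv> (\<lambda>t. (12 * r1 - 6 * r2) * t + (- 6 * r1 + 2 * r2))"
    and "M \<equiv> 6 * r1\<^sup>2 - 6 * r1 * r2 + 2 * r2\<^sup>2"
begin

lemma w_L2: "w \<in> L2_01"
  unfolding w_def by (intro L2_01_continuous continuous_intros)

text \<open>Since \<open>w\<close> is t -> l1*t - (l1 + l2), feasibility is the system l1/3 + l2/2 =
  r1, l1/2 + l2 = r2, which determines the multipliers.\<close>

lemma constr_w: "constr1 r1 w = 0" "constr2 r2 w = 0"
  unfolding w_def by (simp_all only: constr1_affine constr2_affine, simp_all add: field_simps)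

text \<open>Half the squared L2 distance to \<open>w\<close>.\<close>

definition dev :: "(real \<Rightarrow> real) \<Rightarrow> real" where
  "dev u = energy (\<lambda>t. u t - w t)"

lemma dev_eq: "dev u = energy (\<lambda>t. u t + (- l1 * t + (l1 + l2)))"
  by (simp add: dev_def w_def l1_def l2_def algebra_simps)

lemma dev_nonneg: "0 \<le> dev u"
  by (simp add: dev_def energy_nonneg)

lemma dev_le_0:
  assumes "u \<in> L2_01" "dev u \<le> 0"
  shows "AE t in lebesgue. t \<in> {0..1} \<longrightarrow> u t = w t"
  using energy_add_affine_eq_0[of u "- l1" "l1 + l2"] assms
  by (simp add: dev_eq w_def l1_def l2_def algebra_simps)

text \<open>The square is completed with the multipliers as weights. The remaining constant is
  \<open>M\<close>, because l1*r1 + l2*r2 = 2*M and \<open>energy w\<close> = M. No sign of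
  \<open>c\<close> is assumed, so c = 0 yields the energy itself.\<close>

lemma penalty_identity:
  assumes "u \<in> L2_01"
  shows "penalty_fun r1 r2 u c = M + dev u
    + (c * \<bar>constr1 r1 u\<bar> - l1 * constr1 r1 u) + (c * \<bar>constr2 r2 u\<bar> - l2 * constr2 r2 u)"
  using energy_complete_square[OF assms, of l1 r1 l2 r2]
  by (simp add: penalty_fun_def dev_eq M_def l1_def l2_def power2_eq_square field_simps)

lemma energy_identity:
  assumes "u \<in> L2_01" "constr1 r1 u = 0" "constr2 r2 u = 0"
  shows "energy u = M + dev u"
  using penalty_identity[OF assms(1), of 0] assms by (simp add: penalty_fun_def)

lemma dev_AE:
  assumes "u \<in> L2_01" "AE t in lebesgue. t \<in> {0..1} \<longrightarrow> u t = w t"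
  shows "dev u = 0" "constr1 r1 u = 0" "constr2 r2 u = 0"
proof -
  have "(LINT t:{0..1}|lebesgue. (u t - w t)\<^sup>2) = 0"
    unfolding set_lebesgue_integral_def
    by (rule integral_eq_zero_AE, use assms(2) in eventually_elim) (auto simp: indicator_def)
  thus "dev u = 0"
    by (simp add: dev_def energy_def)
  have eq: "(LINT s:{0..t}|lebesgue. u s) = (LINT s:{0..t}|lebesgue. w s)" if "t \<in> {0..1}" for t
    using set_integral_AE_cong_subinterval[OF L2_01_integrable[OF assms(1)]
        L2_01_integrable[OF w_L2] assms(2) that] .
  have "(LINT t:{0..1}|lebesgue. (LINT s:{0..t}|lebesgue. u s))
      = (LINT t:{0..1}|lebesgue. (LINT s:{0..t}|lebesgue. w s))"
    using eq by (intro set_lebesgue_integral_cong) auto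
  thus "constr1 r1 u = 0" "constr2 r2 u = 0"
    using constr_w eq[of 1] by (simp_all add: constr1_def constr2_def)
qed

lemma dev_w: "dev w = 0"
  using dev_AE(1)[OF w_L2] by simp

lemma penalty_w: "penalty_fun r1 r2 w c = M"
  by (simp add: penalty_identity[OF w_L2] dev_w constr_w)

lemma penalty_ge:
  assumes "u \<in> L2_01" "\<bar>l1\<bar> \<le> c" "\<bar>l2\<bar> \<le> c"
  shows "M + dev u \<le> penalty_fun r1 r2 u c"
proof -
  have "l * x \<le> c * \<bar>x\<bar>" if "\<bar>l\<bar> \<le> c" for l x :: real
    using mult_right_mono[OF that, of "\<bar>x\<bar>"] abs_ge_self[of "l * x"] by (simp add: abs_mult)
  from this[OF assms(2), of "constr1 r1 u"] this[OF assms(3), of "constr2 r2 u"] show ?thesis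
    by (simp add: penalty_identity[OF assms(1)])
qed

text \<open>At a feasible control both brackets of \<open>penalty_identity\<close> vanish, so
  comparison with \<open>w\<close> leaves no deviation, whatever \<open>c\<close> is. This covers a
  run that ends with exactly satisfied constraints.\<close>

lemma argmin_feasible:
  assumes "u \<in> penalty_argmin r1 r2 c" "constr1 r1 u = 0" "constr2 r2 u = 0"
  shows "u \<in> L2_01" "AE t in lebesgue. t \<in> {0..1} \<longrightarrow> u t = w t"
proof -
  show u: "u \<in> L2_01"
    using assms by (simp add: penalty_argmin_def is_arg_min_def)
  have "penalty_fun r1 r2 u c \<le> penalty_fun r1 r2 w c"
    using assms(1) w_L2 by (force simp: penalty_argmin_def is_arg_min_def)
  hence "dev u \<le> 0"
    using assms(2,3) by (simp add: penalty_w penalty_identity[OF u])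
  with u show "AE t in lebesgue. t \<in> {0..1} \<longrightarrow> u t = w t"
    by (rule dev_le_0)
qed

text \<open>Here feasibility is a consequence: the lower bound \<open>penalty_ge\<close> and the
  value \<open>M\<close> at \<open>w\<close> together force the deviation to vanish.\<close>

lemma argmin_exact:
  assumes "u \<in> penalty_argmin r1 r2 c" "\<bar>l1\<bar> \<le> c" "\<bar>l2\<bar> \<le> c"
  shows "u \<in> L2_01" "AE t in lebesgue. t \<in> {0..1} \<longrightarrow> u t = w t"
proof -
  show u: "u \<in> L2_01"
    using assms by (simp add: penalty_argmin_def is_arg_min_def)
  have "penalty_fun r1 r2 u c \<le> M"
    using assms(1) w_L2 penalty_w[of c] by (force simp: penalty_argmin_def is_arg_min_def)
  with penalty_ge[OF u assms(2,3)] have "dev u \<le> 0" by simp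
  with u show "AE t in lebesgue. t \<in> {0..1} \<longrightarrow> u t = w t"
    by (rule dev_le_0)
qed

lemma w_argmin:
  assumes "\<bar>l1\<bar> \<le> c" "\<bar>l2\<bar> \<le> c"
  shows "w \<in> penalty_argmin r1 r2 c"
proof -
  have "M \<le> penalty_fun r1 r2 u c" if "u \<in> L2_01" for u
    using penalty_ge[OF that assms] dev_nonneg[of u] by simp
  thus ?thesis
    using w_L2 by (force simp: penalty_argmin_def is_arg_min_def penalty_w)
qed

lemma penalty_perturbation:
  "\<exists>u\<in>L2_01. penalty_fun r1 r2 u c
    = M + 6 * p\<^sup>2 - 6 * p * q + 2 * q\<^sup>2 + (c * \<bar>p\<bar> - l1 * p) + (c * \<bar>q\<bar> - l2 * q)"
proof -
  \<comment> \<open>This is the formula for \<open>w\<close> with r1 - p and r2 - q in place of r1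
    and r2, so its constraint values are p and q.\<close>
  define u where "u t = (l1 + 6 * q - 12 * p) * t + (6 * p - 2 * q - l1 - l2)" for t
  have u: "u \<in> L2_01"
    unfolding u_def by (intro L2_01_continuous continuous_intros)
  have p: "constr1 r1 u = p" and q: "constr2 r2 u = q"
    unfolding u_def by (simp_all only: constr1_affine constr2_affine, simp_all add: l1_def l2_def field_simps)
  have eq: "(\<lambda>t. u t + (- l1 * t + (l1 + l2))) = (\<lambda>t. (6 * q - 12 * p) * t + (6 * p - 2 * q))"
    by (auto simp: u_def algebra_simps)
  have "dev u = 6 * p\<^sup>2 - 6 * p * q + 2 * q\<^sup>2"
    unfolding dev_eq energy_def eq set_integral_affine_square
    by (simp add: power2_eq_square field_simps)
  with penalty_identity[OF u, of c] p q u show ?thesis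
    by (intro bexI[of _ u]) auto
qed

text \<open>Only one constraint is violated, in the direction of the sign of its multiplier: the
  linear gain (|l| - c)*d outweighs the quadratic cost k*d^2 for small d > 0.\<close>

lemma penalty_less:
  assumes "0 \<le> c" and less: "c < \<bar>l1\<bar> \<or> c < \<bar>l2\<bar>"
  shows "\<exists>u\<in>L2_01. penalty_fun r1 r2 u c < M"
proof -
  have neg: "\<exists>x. k * x\<^sup>2 + (c * \<bar>x\<bar> - l * x) < 0" if "c < \<bar>l\<bar>" "k > 0" for k l :: real
  proof -
    \<comment> \<open>The minimizer of k*d^2 - (|l| - c)*d; the minimum is -k*d^2.\<close>
    define d where "d = (\<bar>l\<bar> - c) / (2 * k)"
    have "d > 0" "l \<noteq> 0" using that assms(1) by (auto simp: d_def)
    moreover from \<open>l \<noteq> 0\<close> have "(sgn l)\<^sup>2 = 1" "l * sgn l = \<bar>l\<bar>"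
      by (auto simp: sgn_if power2_eq_square)
    ultimately have "k * (sgn l * d)\<^sup>2 + (c * \<bar>sgn l * d\<bar> - l * (sgn l * d))
        = k * d\<^sup>2 + (c * d - \<bar>l\<bar> * d)"
      by (simp add: power_mult_distrib abs_mult mult.assoc[symmetric])
    also have "\<dots> = - k * d\<^sup>2"
      using that(2) by (simp add: d_def power2_eq_square field_simps)
    also have "\<dots> < 0"
      using \<open>d > 0\<close> that(2) by simp
    finally show ?thesis by blast
  qed
  from less show ?thesis
  proof
    assume "c < \<bar>l1\<bar>"
    \<comment> \<open>The constants 6 here and 2 below are the coefficients of p^2 and q^2 in
      \<open>penalty_perturbation\<close> once the other variable is 0.\<close>
    then obtain p where "6 * p\<^sup>2 + (c * \<bar>p\<bar> - l1 * p) < 0" using neg[of l1 6] by auto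
    with penalty_perturbation[of c p 0] show ?thesis by force
  next
    assume "c < \<bar>l2\<bar>"
    then obtain q where "2 * q\<^sup>2 + (c * \<bar>q\<bar> - l2 * q) < 0" using neg[of l2 2] by auto
    with penalty_perturbation[of c 0 q] show ?thesis by force
  qed
qed

text \<open>A control equal to \<open>w\<close> almost everywhere has penalty value
  \<open>M\<close>, and \<open>penalty_less\<close> provides a strictly smaller one.\<close>

lemma argmin_inexact:
  assumes "u \<in> penalty_argmin r1 r2 c" "0 \<le> c" "c < \<bar>l1\<bar> \<or> c < \<bar>l2\<bar>"
  shows "\<not> (AE t in lebesgue. t \<in> {0..1} \<longrightarrow> u t = w t)"
proof
  assume ae: "AE t in lebesgue. t \<in> {0..1} \<longrightarrow> u t = w t"
  have u: "u \<in> L2_01"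
    using assms by (simp add: penalty_argmin_def is_arg_min_def)
  have "penalty_fun r1 r2 u c = M"
    by (simp add: penalty_identity[OF u] dev_AE[OF u ae])
  with penalty_less[OF assms(2,3)] assms(1) show False
    by (force simp: penalty_argmin_def is_arg_min_def)
qed

lemma dual_le:
  assumes "0 \<le> c"
  shows "dual_fun r1 r2 c \<le> M"
proof -
  \<comment> \<open>An infimum of reals lies below the value at \<open>w\<close> only if the set is
    bounded below; for c >= 0 the bound is 0.\<close>
  have "bdd_below ((\<lambda>u. penalty_fun r1 r2 u c) ` L2_01)"
    using assms by (intro bdd_belowI2[of _ 0]) (simp add: penalty_fun_def energy_nonneg)
  from cINF_lower[OF this w_L2] show ?thesis
    by (simp add: dual_fun_def penalty_w)
qed

lemma dual_exact:
  assumes "\<bar>l1\<bar> \<le> c" "\<bar>l2\<bar> \<le> c"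
  shows "dual_fun r1 r2 c = M"
proof (rule antisym)
  show "dual_fun r1 r2 c \<le> M"
    using assms by (intro dual_le) linarith
  have "M \<le> penalty_fun r1 r2 u c" if "u \<in> L2_01" for u
    using penalty_ge[OF that assms] dev_nonneg[of u] by simp
  thus "M \<le> dual_fun r1 r2 c"
    unfolding dual_fun_def using w_L2 by (intro cINF_greatest) auto
qed

text \<open>Every feasible control has energy \<open>M\<close> plus its deviation from
  \<open>w\<close>, so the minimizers are those with zero deviation. Null sets remain because
  controls are functions, not classes.\<close>

lemma solutions_P_iff:
  assumes "r1 = v0 + s0 - sf" "r2 = v0 - vf"
  shows "u \<in> solutions_P s0 sf v0 vf \<longleftrightarrow>
    u \<in> L2_01 \<and> (AE t in lebesgue. t \<in> {0..1} \<longrightarrow> u t = w t)"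
proof
  note feas = feasible_P_iff[of s0 sf v0 vf, folded assms]
  show "u \<in> L2_01 \<and> (AE t in lebesgue. t \<in> {0..1} \<longrightarrow> u t = w t)"
    if "u \<in> solutions_P s0 sf v0 vf"
  proof -
    have u: "u \<in> L2_01" "constr1 r1 u = 0" "constr2 r2 u = 0"
      using that by (simp_all add: solutions_P_def is_arg_min_def feas)
    have "energy u \<le> energy w"
      using that w_L2 constr_w by (force simp: solutions_P_def is_arg_min_def feas)
    with energy_identity[OF u] energy_identity[OF w_L2 constr_w] dev_w have "dev u \<le> 0"
      by simp
    with u(1) show ?thesis using dev_le_0 by blast
  qed
  show "u \<in> solutions_P s0 sf v0 vf"
    if u: "u \<in> L2_01 \<and> (AE t in lebesgue. t \<in> {0..1} \<longrightarrow> u t = w t)"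
  proof -
    have "energy u = M"
      using u dev_AE[of u] by (simp add: energy_identity)
    moreover have "M \<le> energy y" if "feasible_P s0 sf v0 vf y" for y
      using that energy_identity[of y] dev_nonneg[of y] by (simp add: feas)
    ultimately show ?thesis
      using u dev_AE[of u] by (force simp: solutions_P_def is_arg_min_def feas)
  qed
qed

end

theorem corollary3p2:
  fixes s0 sf v0 vf r1 r2 c1 c2 cbar :: real
  assumes r1: "r1 = v0 + s0 - sf" and r2: "r2 = v0 - vf"
    and c1: "c1 = - 12 * (sf - s0) + 6 * (v0 + vf)"
    and c2: "c2 = 6 * (sf - s0) - 2 * (2 * v0 + vf)"
    and cbar: "cbar = max \<bar>12 * r1 - 6 * r2\<bar> \<bar>- 6 * r1 + 4 * r2\<bar>"
  shows
    "(\<forall>u. u \<in> solutions_P s0 sf v0 vf \<longleftrightarrow>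
          u \<in> L2_01 \<and> (AE t in lebesgue. t \<in> {0..1} \<longrightarrow> u t = c1 * t + c2)) \<and>
     (\<forall>\<alpha> \<epsilon> a s c u N.
        pdp_run r1 r2 \<alpha> \<epsilon> a s c u N \<and> constr1 r1 (u N) = 0 \<and> constr2 r2 (u N) = 0 \<longrightarrow>
          u N \<in> solutions_P s0 sf v0 vf \<and>
          (AE t in lebesgue. t \<in> {0..1} \<longrightarrow> u N t = c1 * t + c2) \<and>
          (\<forall>t\<in>{0..1}.
             state1 s0 v0 (u N) t = 1/6 * c1 * t^3 + 1/2 * c2 * t^2 + v0 * t + s0 \<and>
             state2 v0 (u N) t = 1/2 * c1 * t^2 + c2 * t + v0)) \<and>
     (\<forall>\<alpha> \<epsilon> a. 0 < \<alpha> \<and> 0 < \<epsilon> \<and> (\<forall>k. 0 < a k \<and> a k < \<alpha>) \<longrightarrow>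
        (\<exists>s c u N. pdp_run r1 r2 \<alpha> \<epsilon> a s c u N \<and> constr1 r1 (u N) = 0 \<and> constr2 r2 (u N) = 0)) \<and>
     (r1 \<noteq> 0 \<or> r2 \<noteq> 0 \<longrightarrow> least_exact_penalty_param s0 sf v0 vf cbar) \<and>
     (r1 = 0 \<and> r2 = 0 \<longrightarrow>
        (\<forall>c\<ge>cbar. penalty_argmin r1 r2 c \<subseteq> solutions_P s0 sf v0 vf)) \<and>
     dual_fun r1 r2 cbar = 6 * r1^2 - 6 * r1 * r2 + 2 * r2^2 \<and>
     (\<forall>c\<ge>0. dual_fun r1 r2 c \<le> dual_fun r1 r2 cbar)"
proof -
  define l1 where "l1 = 12 * r1 - 6 * r2"
  define l2 where "l2 = - 6 * r1 + 4 * r2"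
  define w where "w = (\<lambda>t. (12 * r1 - 6 * r2) * t + (- 6 * r1 + 2 * r2))"
  define M where "M = 6 * r1\<^sup>2 - 6 * r1 * r2 + 2 * r2\<^sup>2"
  interpret penalty_problem r1 r2 l1 l2 w M
    by unfold_locales (simp_all add: l1_def l2_def w_def M_def)
  have w: "w t = c1 * t + c2" for t
    by (simp add: w_def r1 r2 c1 c2 algebra_simps)
  have cbar': "cbar = max \<bar>l1\<bar> \<bar>l2\<bar>"
    by (simp add: cbar l1_def l2_def)
  note sol = solutions_P_iff[OF r1 r2]
  have exact: "penalty_argmin r1 r2 c \<subseteq> solutions_P s0 sf v0 vf" if "cbar \<le> c" for c
    using that argmin_exact[of _ c] by (auto simp: sol cbar')
  have runs: "u N \<in> solutions_P s0 sf v0 vf \<and>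
      (AE t in lebesgue. t \<in> {0..1} \<longrightarrow> u N t = c1 * t + c2) \<and>
      (\<forall>t\<in>{0..1}.
         state1 s0 v0 (u N) t = 1/6 * c1 * t^3 + 1/2 * c2 * t^2 + v0 * t + s0 \<and>
         state2 v0 (u N) t = 1/2 * c1 * t^2 + c2 * t + v0)"
    if "pdp_run r1 r2 \<alpha> \<epsilon> a s c u N" "constr1 r1 (u N) = 0" "constr2 r2 (u N) = 0"
    for \<alpha> \<epsilon> a s c u N
  proof -
    \<comment> \<open>Minimality of the last iterate suffices; its parameter may lie below
      \<open>cbar\<close>.\<close>
    have "u N \<in> penalty_argmin r1 r2 (c N)"
      using that(1) by (simp add: pdp_run_def)
    from argmin_feasible[OF this that(2,3)]
    have "u N \<in> L2_01" "AE t in lebesgue. t \<in> {0..1} \<longrightarrow> u N t = c1 * t + c2"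
      by (simp_all add: w)
    thus ?thesis
      using state_affine[of "u N" c1 c2] by (simp add: sol w)
  qed
  have run: "\<exists>s c u N. pdp_run r1 r2 \<alpha> \<epsilon> a s c u N \<and> constr1 r1 (u N) = 0 \<and> constr2 r2 (u N) = 0"
    if "0 < \<alpha>" "0 < \<epsilon>" "\<forall>k. 0 < a k \<and> a k < \<alpha>" for \<alpha> \<epsilon> and a :: "nat \<Rightarrow> real"
  proof -
    \<comment> \<open>Starting above \<open>cbar\<close>, the algorithm may return \<open>w\<close>
      and stop at iteration 0. The summand 1 keeps the initial parameter positive even if
      \<open>cbar\<close> is 0.\<close>
    have "w \<in> penalty_argmin r1 r2 (cbar + 1)" "0 < cbar + 1"
      by (auto intro!: w_argmin simp: cbar')
    hence "pdp_run r1 r2 \<alpha> \<epsilon> a s (\<lambda>_. cbar + 1) (\<lambda>_. w) 0" for s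
      using that constr_w by (simp add: pdp_run_def constr_norm_inf_def)
    with constr_w show ?thesis by blast
  qed
  have "least_exact_penalty_param s0 sf v0 vf cbar" if "r1 \<noteq> 0 \<or> r2 \<noteq> 0"
  proof -
    \<comment> \<open>The linear map from (r1, r2) to the multipliers is injective, so they vanish
      together only for r1 = r2 = 0.\<close>
    have "0 < cbar"
      using that by (auto simp: cbar' l1_def l2_def)
    moreover have "penalty_argmin r1 r2 c \<inter> solutions_P s0 sf v0 vf = {}" if "0 \<le> c" "c < cbar" for c
      using that argmin_inexact[of _ c] by (auto simp: sol cbar' less_max_iff_disj)
    ultimately show ?thesis
      using exact by (simp add: least_exact_penalty_param_def exact_penalty_param_def flip: r1 r2)
  qed
  moreover have "dual_fun r1 r2 cbar = M"
    by (rule dual_exact) (simp_all add: cbar')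
  ultimately show ?thesis
    using sol exact runs run dual_le by (auto simp: w M_def)
qed

end
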